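(* Let $\sigma\in\{132,213,231,312\}$. There is an absolute constant $C$ such that for every $k\ge1$, every $n$, and every input sequence $X\in[0,1]^n$ that avoids $\sigma$, we have $\mathrm{OPT}_k(X)\le C(k^2+k\cdot n^{1/k})$.
   Context: Two real sequences $(x_1,\dots,x_m)$ and $(y_1,\dots,y_m)$ are order-isomorphic if $x_i<x_j \iff y_i<y_j$ for all $i,j$. A sequence $X$ contains a sequence $Y$ if some (not necessarily contiguous) subsequence of $X$ is order-isomorphic to $Y$; otherwise $X$ avoids $Y$. Here $231$ denotes the sequence $(2,3,1)$, etc. $k$-server on the line: given requests $X=(x_1,\dots,x_n)\in[0,1]^n$ and $k$ servers, let $p_i^j\in[0,1]$ be the position of server $j$ after serving request $i$, with $p_0^j=0$ for all $j$. The positions are a valid solution if for each $i\in[n]$ some $j$ has $p_i^j=x_i$. The cost is $\sum_{i\in[n]}\sum_{j\in[k]}|p_i^j-p_{i-1}^j|$, and $\mathrm{OPT}_k(X)$ is the minimum cost of a valid solution. *)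

theory Defs
  imports "HOL-Analysis.Analysis" "HOL-Library.Sublist"
begin

section \<open>Pattern avoidance\<close>

definition order_isomorphic :: "real list \<Rightarrow> real list \<Rightarrow> bool" where
  "order_isomorphic xs ys \<longleftrightarrow> length xs = length ys \<and>
     (\<forall>i<length xs. \<forall>j<length xs. xs ! i < xs ! j \<longleftrightarrow> ys ! i < ys ! j)"

definition contains :: "real list \<Rightarrow> real list \<Rightarrow> bool" where
  "contains X Y \<longleftrightarrow> (\<exists>Z. subseq Z X \<and> order_isomorphic Z Y)"

definition avoids :: "real list \<Rightarrow> real list \<Rightarrow> bool" where
  "avoids X Y \<longleftrightarrow> \<not> contains X Y"

section \<open>The k-server problem on the line\<close>

text \<open>
  \<open>p i j\<close> is the position of server \<open>j\<close> (servers are numbered \<open>0, \<dots>, k - 1\<close>) after serving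
  request \<open>i\<close> (requests are numbered \<open>1, \<dots>, n\<close>, so that request \<open>i\<close> is \<open>X ! (i - 1)\<close>).
  The values of \<open>p\<close> outside \<open>i \<le> n\<close>, \<open>j < k\<close> play no role.
\<close>

definition valid_solution :: "nat \<Rightarrow> real list \<Rightarrow> (nat \<Rightarrow> nat \<Rightarrow> real) \<Rightarrow> bool" where
  "valid_solution k X p \<longleftrightarrow>
     (\<forall>i\<le>length X. \<forall>j<k. p i j \<in> {0..1}) \<and>
     (\<forall>j<k. p 0 j = 0) \<and>
     (\<forall>i\<in>{1..length X}. \<exists>j<k. p i j = X ! (i - 1))"

definition cost :: "nat \<Rightarrow> nat \<Rightarrow> (nat \<Rightarrow> nat \<Rightarrow> real) \<Rightarrow> real" where
  "cost k n p = (\<Sum>i=1..n. \<Sum>j<k. \<bar>p i j - p (i - 1) j\<bar>)"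

definition OPT :: "nat \<Rightarrow> real list \<Rightarrow> real" where
  "OPT k X = Inf (cost k (length X) ` {p. valid_solution k X p})"

lemma compact_PiE_UNIV:
  fixes T :: "nat \<Rightarrow> 'a::topological_space set"
  assumes "\<And>i. compact (T i)"
  shows "compact (PiE UNIV T)"
  using assms compactin_PiE[of "\<lambda>_. euclidean" UNIV T]
  by (simp add: euclidean_product_topology)

text \<open>
  For \<open>k \<ge> 1\<close> and requests in the unit interval, the infimum in the definition of \<open>OPT\<close> is
  attained, that is, \<open>OPT\<close> is the minimum cost of a valid solution.
\<close>

lemma OPT_minimum:
  assumes k: "k \<ge> 1" and X: "set X \<subseteq> {0..1}"
  shows "\<exists>p. valid_solution k X p \<and> cost k (length X) p = OPT k X"
    and "\<And>p. valid_solution k X p \<Longrightarrow> OPT k X \<le> cost k (length X) p"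
proof -
  define n where "n = length X"
  define S where "S i j = (if i \<le> n \<and> j < k then {0..1::real} else {0})" for i j :: nat
  define B where "B = PiE UNIV (\<lambda>i. PiE UNIV (\<lambda>j. S i j))"
  define V where "V = (\<Inter>j<k. {p. p 0 j = (0::real)}) \<inter>
      (\<Inter>i\<in>{1..n}. \<Union>j<k. {p :: nat \<Rightarrow> nat \<Rightarrow> real. p i j = X ! (i - 1)})"
  have cont: "continuous_on UNIV (\<lambda>p :: nat \<Rightarrow> nat \<Rightarrow> real. p i j)" for i j
    by (rule continuous_on_product_then_coordinatewise[OF continuous_on_product_coordinates])
  have "compact B"
    unfolding B_def by (intro compact_PiE_UNIV) (simp add: S_def)
  moreover have "closed V"
    unfolding V_def by (intro closed_Int closed_INT ballI closed_UN finite_lessThan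
        closed_Collect_eq cont continuous_on_const)
  ultimately have comp: "compact (B \<inter> V)" by (rule compact_Int_closed)
  have B_iff: "p \<in> B \<longleftrightarrow> (\<forall>i j. p i j \<in> S i j)" for p
    by (simp add: B_def PiE_UNIV_domain Pi_iff)
  have V_iff: "p \<in> V \<longleftrightarrow> (\<forall>j<k. p 0 j = 0) \<and> (\<forall>i\<in>{1..n}. \<exists>j<k. p i j = X ! (i - 1))" for p
    unfolding V_def by blast
  have valid: "valid_solution k X p" if "p \<in> B \<inter> V" for p
  proof -
    have "p i j \<in> {0..1}" if "i \<le> n" "j < k" for i j
    proof -
      have "p i j \<in> S i j" using \<open>p \<in> B \<inter> V\<close> B_iff by blast
      then show ?thesis using that by (simp add: S_def)
    qed
    then show ?thesis
      using that unfolding valid_solution_def n_def[symmetric] Int_iff V_iff by blast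
  qed
  have "(\<lambda>i j. if 1 \<le> i \<and> i \<le> n \<and> j < k then X ! (i - 1) else 0) \<in> B \<inter> V"
  proof -
    have "X ! (i - 1) \<in> {0..1}" if "1 \<le> i" "i \<le> n" for i
    proof -
      have "i - 1 < length X" using that by (simp add: n_def)
      then show ?thesis using X nth_mem by blast
    qed
    then have "(if 1 \<le> i \<and> i \<le> n \<and> j < k then X ! (i - 1) else 0) \<in> S i j" for i j
      by (auto simp: S_def)
    moreover have "0 < k" using k by simp
    ultimately show ?thesis unfolding Int_iff B_iff V_iff by auto
  qed
  hence ne: "B \<inter> V \<noteq> {}" by blast
  have "continuous_on (B \<inter> V) (cost k n)"
    unfolding cost_def
    by (intro continuous_on_sum continuous_on_rabs continuous_on_diff
        continuous_on_subset[OF cont] subset_UNIV)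
  from continuous_attains_inf[OF comp ne this]
  obtain p where p: "p \<in> B \<inter> V" and min: "\<And>q. q \<in> B \<inter> V \<Longrightarrow> cost k n p \<le> cost k n q" by blast
  have le: "cost k n p \<le> cost k n q" if q: "valid_solution k X q" for q
  proof -
    define q' where "q' i j = (if i \<le> n \<and> j < k then q i j else 0)" for i j
    have "q' i j \<in> S i j" for i j
      using q by (simp add: q'_def S_def valid_solution_def n_def)
    moreover have "q' \<in> V"
    proof -
      have "\<exists>j<k. q' i j = X ! (i - 1)" if i: "i \<in> {1..n}" for i
      proof -
        obtain j where "j < k" "q i j = X ! (i - 1)"
          using q i unfolding valid_solution_def n_def by blast
        then show ?thesis using i by (intro exI[of _ j]) (simp add: q'_def)
      qed
      then show ?thesis using q unfolding V_iff by (simp add: q'_def valid_solution_def)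
    qed
    ultimately have "q' \<in> B \<inter> V" unfolding Int_iff B_iff by blast
    moreover have "cost k n q' = cost k n q"
      unfolding cost_def by (intro sum.cong refl) (auto simp: q'_def)
    ultimately show ?thesis using min[of q'] by simp
  qed
  have opt: "OPT k X = cost k n p"
    unfolding OPT_def n_def[symmetric]
    by (rule cInf_eq_minimum) (use valid[OF p] le in blast)+
  show "\<exists>p. valid_solution k X p \<and> cost k (length X) p = OPT k X"
    using opt valid[OF p] by (auto simp: n_def)
  show "OPT k X \<le> cost k (length X) q" if "valid_solution k X q" for q
    using opt le[OF that] by (simp add: n_def)
qed

end

theory Submission
  imports Defs
begin

text \<open>
  A sequence avoiding 231 is the preorder traversal of a binary search tree: after its first
  element \<open>x\<close> come all the elements up to \<open>x\<close>, then all those from \<open>x\<close> on. For every \<open>N \<ge> 1\<close>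
  one shows by induction on \<open>k\<close> that \<open>k\<close> servers can sweep from one end of an interval of width \<open>w\<close>
  to the other while serving up to \<open>N ^ k\<close> such requests at cost \<open>k * (2 * N + 3) * w\<close>; then
  \<open>N \<approx> n powr (1/k)\<close> is chosen. For the step from \<open>k\<close> to \<open>k + 1\<close>
  servers, call a subtree small if it has at most \<open>N ^ k\<close> nodes. The maximal small subtrees
  appear from left to right, so \<open>k\<close> servers serve all of them in a single sweep. A root
  with a small left subtree is served by a detour of a sweeping server across the interval of that
  subtree. All other roots are served by the additional server, which is kept at the right
  end of the current interval; its trips are paid for by the size of the large left subtree.
  The other three patterns reduce to 231 by reversing time and reflecting \<open>[0,1]\<close>, at an additional
  cost of at most \<open>k\<close> each for the changed initial positions.
\<close>

section \<open>Preorder traversals of binary search trees\<close>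

text \<open>Both child intervals are closed at the root \<open>x\<close>, so requests equal to
  \<open>x\<close> may lie in either subtree.\<close>

inductive preorder_in :: "real \<Rightarrow> real \<Rightarrow> real list \<Rightarrow> bool" where
  Nil: "a \<le> b \<Longrightarrow> preorder_in a b []"
| Cons: "preorder_in a x A \<Longrightarrow> preorder_in x b B \<Longrightarrow> preorder_in a b (x # A @ B)"

lemma preorder_in_le: "preorder_in a b X \<Longrightarrow> a \<le> b"
  by (induction rule: preorder_in.induct) auto

lemma preorder_in_set: "preorder_in a b X \<Longrightarrow> set X \<subseteq> {a..b}"
proof (induction rule: preorder_in.induct)
  case (Cons a x A b B)
  then show ?case using preorder_in_le[OF Cons(1)] preorder_in_le[OF Cons(2)] by force
qed simp

section \<open>Patterns of length three\<close>

lemma all_less_three: "(\<forall>i<3. P i) \<longleftrightarrow> P 0 \<and> P 1 \<and> P (2::nat)"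
  by (simp add: numeral_3_eq_3 numeral_2_eq_2 All_less_Suc conj_ac)

lemma contains_three_iff:
  "contains X [p, q, r] \<longleftrightarrow>
     (\<exists>u v w. subseq [u, v, w] X \<and> (u < v \<longleftrightarrow> p < q) \<and> (u < w \<longleftrightarrow> p < r) \<and> (v < w \<longleftrightarrow> q < r) \<and>
       (v < u \<longleftrightarrow> q < p) \<and> (w < u \<longleftrightarrow> r < p) \<and> (w < v \<longleftrightarrow> r < q))"
proof -
  have *: "(\<exists>Z. length Z = 3 \<and> Q Z) \<longleftrightarrow> (\<exists>u v w. Q [u, v, w])" for Q :: "real list \<Rightarrow> bool"
  proof
    assume "\<exists>Z. length Z = 3 \<and> Q Z"
    then obtain Z where "length Z = 3" "Q Z" by blast
    then show "\<exists>u v w. Q [u, v, w]"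
      by (auto simp: numeral_3_eq_3 length_Suc_conv)
  next
    assume "\<exists>u v w. Q [u, v, w]"
    then obtain u v w where "Q [u, v, w]" by blast
    then show "\<exists>Z. length Z = 3 \<and> Q Z" by (intro exI[of _ "[u, v, w]"]) simp
  qed
  have "contains X [p, q, r] \<longleftrightarrow> (\<exists>Z. length Z = 3 \<and> subseq Z X \<and>
      (\<forall>i<3. \<forall>j<3. Z ! i < Z ! j \<longleftrightarrow> [p, q, r] ! i < [p, q, r] ! j))"
    unfolding contains_def order_isomorphic_def by (auto simp: numeral_3_eq_3)
  also have "\<dots> \<longleftrightarrow> (\<exists>u v w. subseq [u, v, w] X \<and> (u < v \<longleftrightarrow> p < q) \<and> (u < w \<longleftrightarrow> p < r) \<and>
      (v < w \<longleftrightarrow> q < r) \<and> (v < u \<longleftrightarrow> q < p) \<and> (w < u \<longleftrightarrow> r < p) \<and> (w < v \<longleftrightarrow> r < q))"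
    unfolding * all_less_three by auto
  finally show ?thesis .
qed

text \<open>By transitivity the two strict inequalities determine all six comparisons; likewise for
  the other three patterns.\<close>

lemma avoids_132_iff:
  "avoids X [1,3,2] \<longleftrightarrow> (\<forall>u v w. subseq [u, v, w] X \<longrightarrow> \<not> (u < w \<and> w < v))"
proof -
  have "contains X [1,3,2] \<longleftrightarrow> (\<exists>u v w. subseq [u, v, w] X \<and> u < w \<and> w < v)"
    unfolding contains_three_iff by (intro ex_cong1, rule conj_cong[OF refl]) auto
  then show ?thesis unfolding avoids_def by blast
qed

lemma avoids_213_iff:
  "avoids X [2,1,3] \<longleftrightarrow> (\<forall>u v w. subseq [u, v, w] X \<longrightarrow> \<not> (v < u \<and> u < w))"
proof -
  have "contains X [2,1,3] \<longleftrightarrow> (\<exists>u v w. subseq [u, v, w] X \<and> v < u \<and> u < w)"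
    unfolding contains_three_iff by (intro ex_cong1, rule conj_cong[OF refl]) auto
  then show ?thesis unfolding avoids_def by blast
qed

lemma avoids_231_iff:
  "avoids X [2,3,1] \<longleftrightarrow> (\<forall>u v w. subseq [u, v, w] X \<longrightarrow> \<not> (w < u \<and> u < v))"
proof -
  have "contains X [2,3,1] \<longleftrightarrow> (\<exists>u v w. subseq [u, v, w] X \<and> w < u \<and> u < v)"
    unfolding contains_three_iff by (intro ex_cong1, rule conj_cong[OF refl]) auto
  then show ?thesis unfolding avoids_def by blast
qed

lemma avoids_312_iff:
  "avoids X [3,1,2] \<longleftrightarrow> (\<forall>u v w. subseq [u, v, w] X \<longrightarrow> \<not> (v < w \<and> w < u))"
proof -
  have "contains X [3,1,2] \<longleftrightarrow> (\<exists>u v w. subseq [u, v, w] X \<and> v < w \<and> w < u)"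
    unfolding contains_three_iff by (intro ex_cong1, rule conj_cong[OF refl]) auto
  then show ?thesis unfolding avoids_def by blast
qed

lemma avoids_subseq: "avoids X Y \<Longrightarrow> subseq X' X \<Longrightarrow> avoids X' Y"
  unfolding avoids_def contains_def by (meson subseq_order.trans)

lemma avoids_231_preorder_in:
  assumes "avoids X [2,3,1]" "set X \<subseteq> {a..b}" "a \<le> b"
  shows "preorder_in a b X"
  using assms
proof (induction X arbitrary: a b rule: length_induct)
  case (1 X)
  show ?case
  proof (cases X)
    case Nil
    then show ?thesis using 1(4) by (simp add: preorder_in.Nil)
  next
    case (Cons x Y)
    \<comment> \<open>The cut is at the first entry above \<open>x\<close>; ties with
      \<open>x\<close> before it go to the left subtree.\<close>
    define A where "A = takeWhile (\<lambda>y. y \<le> x) Y"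
    define B where "B = dropWhile (\<lambda>y. y \<le> x) Y"
    have Y: "Y = A @ B" by (simp add: A_def B_def)
    have x: "a \<le> x" "x \<le> b" using 1(3) Cons by auto
    have A: "set A \<subseteq> {a..x}"
      using 1(3) Cons by (force simp: A_def dest: set_takeWhileD)
    have B: "set B \<subseteq> {x..b}"
    proof
      fix z assume z: "z \<in> set B"
      then obtain y B' where B': "B = y # B'" by (cases B) auto
      have y: "x < y"
        using B' dropWhile_eq_Cons_conv[of "\<lambda>y. y \<le> x" Y y B'] by (auto simp: B_def)
      have "x \<le> z"
      proof (rule ccontr)
        assume "\<not> x \<le> z"
        \<comment> \<open>As \<open>y\<close> is above \<open>x\<close>, an entry \<open>z\<close>
          below \<open>x\<close> comes after \<open>y\<close> and completes a 231.\<close>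
        with z y B' have "z \<in> set B'" by auto
        then have "subseq [x, y, z] X"
          unfolding Cons Y B' by (auto intro: list_emb_append2 simp: subseq_singleton_left)
        with y \<open>\<not> x \<le> z\<close> 1(2) show False unfolding avoids_231_iff by auto
      qed
      then show "z \<in> {x..b}" using z 1(3) Cons Y by auto
    qed
    have "subseq A X" "subseq B X"
      unfolding Cons Y by (intro list_emb_Cons subseq_rev_drop_many subseq_drop_many subseq_order.refl)+
    then have "avoids A [2,3,1]" "avoids B [2,3,1]"
      using avoids_subseq[OF 1(2)] by blast+
    moreover have "length A < length X" "length B < length X"
      by (simp_all add: Cons Y)
    ultimately have "preorder_in a x A" "preorder_in x b B"
      using 1(1) A B x by blast+
    then show ?thesis unfolding Cons Y by (rule preorder_in.Cons)
  qed
qed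

section \<open>Server movements\<close>

definition move_cost :: "nat \<Rightarrow> (nat \<Rightarrow> real) \<Rightarrow> (nat \<Rightarrow> real) \<Rightarrow> real" where
  "move_cost k P Q = (\<Sum>j<k. \<bar>Q j - P j\<bar>)"

lemma move_cost_triangle: "move_cost k P R \<le> move_cost k P Q + move_cost k Q R"
  unfolding move_cost_def sum.distrib[symmetric] by (intro sum_mono) auto

lemma move_cost_commute: "move_cost k P Q = move_cost k Q P"
  unfolding move_cost_def by (simp add: abs_minus_commute)

lemma move_cost_nonneg: "0 \<le> move_cost k P Q"
  unfolding move_cost_def by (simp add: sum_nonneg)

lemma move_cost_self: "move_cost k P P = 0"
  unfolding move_cost_def by simp

lemma move_cost_upd: "j < k \<Longrightarrow> move_cost k P (P(j := x)) = \<bar>x - P j\<bar>"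
  unfolding move_cost_def by (simp add: sum.remove[of _ j])

lemma move_cost_extend: "move_cost (Suc k) (P(k := r)) (Q(k := r)) = move_cost k P Q"
  unfolding move_cost_def by simp

lemma move_cost_le:
  assumes "\<And>j. j < k \<Longrightarrow> P j \<in> {0..1}" "\<And>j. j < k \<Longrightarrow> Q j \<in> {0..1}"
  shows "move_cost k P Q \<le> real k"
proof -
  have "\<bar>Q j - P j\<bar> \<le> 1" if "j < k" for j
    using assms[OF that] by auto
  then have "move_cost k P Q \<le> (\<Sum>j<k. 1)"
    unfolding move_cost_def by (intro sum_mono) auto
  then show ?thesis by simp
qed

text \<open>
  Positions are unrestricted here; they are clamped to \<open>[0,1]\<close> in the passage to
  \<^const>\<open>valid_solution\<close>.
\<close>

inductive serves :: "nat \<Rightarrow> (nat \<Rightarrow> real) \<Rightarrow> real list \<Rightarrow> (nat \<Rightarrow> real) \<Rightarrow> real \<Rightarrow> bool" for k where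
  Nil: "move_cost k P Q \<le> c \<Longrightarrow> serves k P [] Q c"
| Cons: "j < k \<Longrightarrow> P' j = x \<Longrightarrow> serves k P' X Q c' \<Longrightarrow> move_cost k P P' + c' \<le> c \<Longrightarrow>
    serves k P (x # X) Q c"

lemma serves_mono: "serves k P X Q c \<Longrightarrow> c \<le> d \<Longrightarrow> serves k P X Q d"
  by (induction rule: serves.induct) (auto intro: serves.intros)

text \<open>The initial move merges with the first move of the schedule by the triangle
  inequality.\<close>

lemma serves_move:
  assumes "serves k P X Q c"
  shows "serves k P' X Q (move_cost k P' P + c)"
  using assms
proof cases
  case Nil
  then show ?thesis
    using move_cost_triangle[of k P' Q P] by (auto intro: serves.Nil)
next
  case (Cons j P1 x X' c')
  then show ?thesis
    using move_cost_triangle[of k P' P1 P] by (auto intro!: serves.Cons[of j k P1])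
qed

lemma serves_append:
  assumes "serves k P X Q c" "serves k Q Y R d"
  shows "serves k P (X @ Y) R (c + d)"
  using assms
proof (induction rule: serves.induct)
  case (Nil P Q c)
  then show ?case using serves_mono[OF serves_move[OF Nil(2), of P]] by simp
next
  case (Cons j P' x X Q c' P c)
  then show ?case by (auto intro!: serves.Cons[of j k P' _ _ _ "c' + d"])
qed

text \<open>Server \<open>k\<close> stays parked at \<open>r\<close> and adds nothing to any
  move.\<close>

lemma serves_extend:
  "serves k P X Q c \<Longrightarrow> serves (Suc k) (P(k := r)) X (Q(k := r)) c"
proof (induction rule: serves.induct)
  case (Nil P Q c)
  then show ?case by (intro serves.Nil) (simp only: move_cost_extend)
next
  case (Cons j P' x X Q c' P c)
  then show ?case
    by (intro serves.Cons[of j _ "P'(k := r)" _ _ _ c', OF _ _ Cons.IH])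
      (simp_all add: move_cost_extend del: fun_upd_apply, simp)
qed

lemma serves_single: "j < k \<Longrightarrow> serves k P [x] (P(j := x)) \<bar>x - P j\<bar>"
  by (rule serves.Cons[of j k "P(j := x)" _ _ _ 0])
    (simp_all only: move_cost_upd serves.Nil move_cost_self fun_upd_same add_0_right order.refl)

lemma serves_detour:
  assumes "j < k"
  shows "serves k P [x] P (2 * \<bar>x - P j\<bar>)"
proof -
  have "serves k (P(j := x)) [] P \<bar>x - P j\<bar>"
    using assms by (intro serves.Nil) (simp add: move_cost_commute[of _ "P(j := x)"] move_cost_upd)
  from serves_append[OF serves_single[OF assms] this] show ?thesis by simp
qed

section \<open>Sweeping strategies\<close>

text \<open>Each request and the final move cost at most the width \<open>b - a\<close>. This is the
  base case of the recursion on servers.\<close>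

lemma serves_one:
  assumes "set X \<subseteq> {a..b}" "y \<in> {a..b}" "z \<in> {a..b}"
  shows "serves 1 (\<lambda>_. y) X (\<lambda>_. z) ((real (length X) + 1) * (b - a))"
  using assms
proof (induction X arbitrary: y)
  case Nil
  then show ?case by (auto intro!: serves.Nil simp: move_cost_def)
next
  case (Cons x X)
  then show ?case
    by (intro serves.Cons[of 0 1 "\<lambda>_. x" _ _ _ "(real (length X) + 1) * (b - a)"])
      (auto simp: move_cost_def algebra_simps)
qed

text \<open>In the factor, \<open>c\<close> pays for sweeping small subtrees, \<open>2\<close> for
  detours to roots with a small left subtree, and the last term for the trips of server
  \<open>k\<close>.\<close>

lemma serves_additional_server:
  fixes s c :: real
  assumes k: "k \<ge> 1" and s: "s > 0"
    and small: "\<And>a b A. preorder_in a b A \<Longrightarrow> real (length A) \<le> s \<Longrightarrow>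
      serves k (\<lambda>_. a) A (\<lambda>_. b) (c * (b - a))"
    and X: "preorder_in a b X"
  shows "serves (Suc k) ((\<lambda>_. a)(k := b)) X (\<lambda>_. b) ((c + 2 + 2 * real (length X) / s) * (b - a))"
  using X
proof (induction rule: preorder_in.induct)
  case (Nil a b)
  \<comment> \<open>Even without requests the servers must reach \<open>b\<close>; the empty list
    counts as small.\<close>
  have "serves k (\<lambda>_. a) [] (\<lambda>_. b) (c * (b - a))"
    using small[of a b "[]"] Nil s by (simp add: preorder_in.Nil)
  from serves_extend[OF this, of b]
  have "serves (Suc k) ((\<lambda>_. a)(k := b)) [] (\<lambda>_. b) (c * (b - a))"
    by (simp add: fun_upd_idem)
  then show ?case
    by (rule serves_mono) (use Nil in \<open>simp add: algebra_simps\<close>)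
next
  case (Cons a x A b B)
  let ?P = "\<lambda>a b. (\<lambda>_. a)(k := b) :: nat \<Rightarrow> real"
  define l m where "l = real (length A) / s" and "m = real (length B) / s"
  have ax: "a \<le> x" "x \<le> b" using Cons preorder_in_le by auto
  have lm: "0 \<le> l" "0 \<le> m" using s by (auto simp: l_def m_def)
  have IHA: "serves (Suc k) (?P a x) A (\<lambda>_. x) ((c + 2 + 2 * l) * (x - a))"
    using Cons.IH(1) unfolding l_def by (simp del: fun_upd_apply)
  have IHB: "serves (Suc k) (?P x b) B (\<lambda>_. b) ((c + 2 + 2 * m) * (b - x))"
    using Cons.IH(2) unfolding m_def by (simp del: fun_upd_apply)
  define t where "t = real (length (x # A @ B)) / s"
  \<comment> \<open>Sizes are measured in units of \<open>s\<close>; the share \<open>1 / s\<close>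
    of the root is given away.\<close>
  have "l + m \<le> t"
    using s by (simp add: l_def m_def t_def field_simps)
  then have "(c + 2 + 2 * (l + m)) * (b - a) \<le> (c + 2 + 2 * t) * (b - a)"
    using ax by (intro mult_right_mono) auto
  then have bound: "(c + 2 + 2 * (l + m)) * (b - a) \<le>
      (c + 2 + 2 * real (length (x # A @ B)) / s) * (b - a)"
    by (simp only: t_def times_divide_eq_right)
  show ?case
  proof (cases "real (length A) \<le> s")
    case True
    \<comment> \<open>Since \<open>k >= 1\<close>, server 0 is not the parked one and stands at
      \<open>a\<close>.\<close>
    have "serves (Suc k) (?P a b) [x] (?P a b) (2 * (x - a))"
      using serves_detour[of 0 "Suc k" "?P a b" x] k ax by simp
    moreover have "serves (Suc k) (?P a b) A (?P x b) (c * (x - a))"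
      by (rule serves_extend[OF small[OF Cons(1) True]])
    ultimately have "serves (Suc k) (?P a b) ([x] @ A @ B) (\<lambda>_. b)
        (2 * (x - a) + (c * (x - a) + (c + 2 + 2 * m) * (b - x)))"
      using IHB by (intro serves_append)
    moreover have "m * (x - a) \<ge> 0" "l * (b - a) \<ge> 0"
      using lm ax by auto
    then have "2 * (x - a) + (c * (x - a) + (c + 2 + 2 * m) * (b - x)) \<le>
        (c + 2 + 2 * (l + m)) * (b - a)"
      by (simp add: algebra_simps)
    ultimately show ?thesis
      unfolding append_Cons append_Nil by (rule serves_mono[OF _ order_trans[OF _ bound]])
  next
    case False
    \<comment> \<open>A large left subtree pays \<open>2 * l * (b - x)\<close>, enough for the two
      trips of server \<open>k\<close> between \<open>b\<close> and \<open>x\<close>.\<close>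
    then have "l \<ge> 1" using s by (simp add: l_def)
    then have "b - x \<le> l * (b - x)" "0 \<le> m * (x - a)"
      using ax lm mult_right_mono[of 1 l "b - x"] by auto
    then have le: "(b - x) + ((c + 2 + 2 * l) * (x - a) + ((b - x) + (c + 2 + 2 * m) * (b - x))) \<le>
        (c + 2 + 2 * (l + m)) * (b - a)"
      by (simp add: algebra_simps)
    \<comment> \<open>Serving the root puts server \<open>k\<close> at the right end of the interval
      of \<open>A\<close>. After \<open>A\<close> all servers are at \<open>x\<close>, and server
      \<open>k\<close> returns to \<open>b\<close> for \<open>B\<close>.\<close>
    have "serves (Suc k) (?P a b) [x] (?P a x) (b - x)"
      using serves_single[of k "Suc k" "?P a b" x] ax by simp
    moreover have "move_cost (Suc k) (\<lambda>_. x) (?P x b) = b - x"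
      using move_cost_upd[of k "Suc k" "\<lambda>_. x" b] ax by simp
    then have "serves (Suc k) (\<lambda>_. x) B (\<lambda>_. b) ((b - x) + (c + 2 + 2 * m) * (b - x))"
      using serves_move[OF IHB, of "\<lambda>_. x"] by simp
    ultimately have "serves (Suc k) (?P a b) ([x] @ A @ B) (\<lambda>_. b)
        ((b - x) + ((c + 2 + 2 * l) * (x - a) + ((b - x) + (c + 2 + 2 * m) * (b - x))))"
      using IHA by (intro serves_append)
    then show ?thesis
      unfolding append_Cons append_Nil by (rule serves_mono[OF _ order_trans[OF le bound]])
  qed
qed

lemma serves_preorder_in:
  assumes "k \<ge> 1" "N \<ge> 1" "preorder_in a b X" "length X \<le> N ^ k"
  shows "serves k (\<lambda>_. a) X (\<lambda>_. b) (real k * (2 * real N + 3) * (b - a))"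
  using assms(1,3,4)
proof (induction k arbitrary: a b X rule: dec_induct)
  case base
  have ab: "a \<le> b" using base preorder_in_le by simp
  have "serves 1 (\<lambda>_. a) X (\<lambda>_. b) ((real (length X) + 1) * (b - a))"
    by (rule serves_one[OF preorder_in_set[OF base(1)]]) (use ab in auto)
  then show ?case
    by (rule serves_mono) (use base ab in \<open>auto intro!: mult_right_mono\<close>)
next
  case (step k)
  have ab: "a \<le> b" using step preorder_in_le by simp
  let ?c = "real k * (2 * real N + 3)"
  let ?t = "real (length X) / real (N ^ k)"
  have s: "0 < real (N ^ k)" using assms(2) by simp
  have "serves (Suc k) ((\<lambda>_. a)(k := b)) X (\<lambda>_. b)
      ((?c + 2 + 2 * real (length X) / real (N ^ k)) * (b - a))"
    by (rule serves_additional_server[OF step(1) s _ step(4)]) (use step in auto)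
  \<comment> \<open>Sending server \<open>k\<close> from \<open>a\<close> to \<open>b\<close> first
    costs another \<open>b - a\<close>, which turns the 2 into 3.\<close>
  from serves_move[OF this, of "\<lambda>_. a"]
  have "serves (Suc k) (\<lambda>_. a) X (\<lambda>_. b) ((b - a) + (?c + 2 + 2 * ?t) * (b - a))"
    using ab move_cost_upd[of k "Suc k" "\<lambda>_. a" b] by simp
  moreover have "real (length X) \<le> real (N ^ Suc k)"
    using step(5) by (simp only: of_nat_le_iff)
  \<comment> \<open>With \<open>s = N ^ k\<close>, the trips of the new server thus cost at most
    \<open>2 * N\<close> per unit width.\<close>
  then have "?t \<le> real N" using s by (simp add: field_simps)
  then have "(?c + 3 + 2 * ?t) * (b - a) \<le> (?c + 3 + 2 * real N) * (b - a)"
    using ab by (intro mult_right_mono) auto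
  then have "(b - a) + (?c + 2 + 2 * ?t) * (b - a) \<le> real (Suc k) * (2 * real N + 3) * (b - a)"
    by (simp add: algebra_simps)
  ultimately show ?case by (rule serves_mono)
qed

section \<open>Bounds on the optimal cost\<close>

lemma cost_eq_move_cost: "cost k n p = (\<Sum>i<n. move_cost k (p i) (p (Suc i)))"
  unfolding cost_def move_cost_def
  by (rule sum.reindex_bij_witness[of _ Suc "\<lambda>i. i - 1"]) auto

lemma serves_solution:
  assumes "serves k P X Q c"
  shows "\<exists>p. p 0 = P \<and> (\<forall>i<length X. \<exists>j<k. p (Suc i) j = X ! i) \<and> cost k (length X) p \<le> c"
  using assms
proof (induction rule: serves.induct)
  case (Nil P Q c)
  then have "0 \<le> c"
    using move_cost_nonneg order_trans by blast
  then show ?case by (auto simp: cost_def)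
next
  case (Cons j P' x X Q c' P c)
  then obtain p where p: "p 0 = P'" "\<forall>i<length X. \<exists>j<k. p (Suc i) j = X ! i"
    "cost k (length X) p \<le> c'" by blast
  let ?p = "case_nat P p"
  have "cost k (length (x # X)) ?p = move_cost k P P' + cost k (length X) p"
    by (simp add: cost_eq_move_cost sum.lessThan_Suc_shift p(1) del: sum.lessThan_Suc)
  moreover have "\<exists>j<k. ?p (Suc i) j = (x # X) ! i" if "i < length (x # X)" for i
    using that p Cons(1,2) by (cases i) auto
  ultimately show ?case using Cons p by (intro exI[of _ ?p]) auto
qed

lemma serves_OPT_le:
  assumes k: "k \<ge> 1" and X: "set X \<subseteq> {0..1}" and "serves k (\<lambda>_. 0) X Q c"
  shows "OPT k X \<le> c"
proof -
  obtain p where p: "p 0 = (\<lambda>_. 0)" "\<forall>i<length X. \<exists>j<k. p (Suc i) j = X ! i"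
    "cost k (length X) p \<le> c"
    using serves_solution[OF assms(3)] by blast
  \<comment> \<open>Clamping fixes the requests and the start and is 1-Lipschitz, so the cost does
    not grow.\<close>
  define q where "q i j = max 0 (min 1 (p i j))" for i j
  have "\<exists>j<k. q i j = X ! (i - 1)" if i: "i \<in> {1..length X}" for i
  proof -
    have "X ! (i - 1) \<in> {0..1}" using X i by (intro subsetD[OF X] nth_mem) auto
    moreover obtain j where "j < k" "p i j = X ! (i - 1)"
      using p(2)[rule_format, of "i - 1"] i by force
    ultimately show ?thesis by (intro exI[of _ j]) (auto simp: q_def)
  qed
  then have "valid_solution k X q"
    using p(1) by (auto simp: valid_solution_def q_def)
  then have "OPT k X \<le> cost k (length X) q" by (rule OPT_minimum(2)[OF k X])
  also have "\<dots> \<le> cost k (length X) p"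
    unfolding cost_def by (intro sum_mono) (simp add: q_def max_def min_def)
  finally show ?thesis using p(3) by simp
qed

lemma OPT_le_231:
  assumes k: "k \<ge> 1" and X: "set X \<subseteq> {0..1}" and "avoids X [2,3,1]"
  shows "OPT k X \<le> real k * (2 * real (length X) powr (1 / real k) + 5)"
proof -
  define r where "r = real (length X) powr (1 / real k)"
  \<comment> \<open>Rounding down and adding 1 keeps \<open>N >= 1\<close> for empty
    \<open>X\<close>; \<open>N <= r + 1\<close> turns \<open>2 * N + 3\<close> into
    \<open>2 * r + 5\<close>.\<close>
  define N where "N = nat \<lfloor>r\<rfloor> + 1"
  have r: "0 \<le> r" by (simp add: r_def)
  have N: "r \<le> real N" "real N \<le> r + 1" using r by (auto simp: N_def) linarith+
  have "real (length X) = r ^ k"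
    using k by (cases "X = []") (simp_all add: r_def powr_realpow[symmetric] powr_powr)
  also have "\<dots> \<le> real N ^ k" using r N by (intro power_mono) auto
  finally have "length X \<le> N ^ k" by (metis of_nat_le_iff of_nat_power)
  moreover have "preorder_in 0 1 X"
    using assms by (intro avoids_231_preorder_in) auto
  ultimately have "serves k (\<lambda>_. 0) X (\<lambda>_. 1) (real k * (2 * real N + 3) * (1 - 0))"
    using k by (intro serves_preorder_in) (auto simp: N_def)
  from serves_OPT_le[OF k X this]
  have "OPT k X \<le> real k * (2 * real N + 3)" by simp
  also have "\<dots> \<le> real k * (2 * r + 5)" using N by (intro mult_left_mono) auto
  finally show ?thesis by (simp add: r_def)
qed

text \<open>Reversal and reflection do not preserve the start at 0. Here \<open>q i\<close> is the
  configuration serving \<open>X ! i\<close> and \<open>q 0\<close> is free; reaching it costs at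
  most 1 per server.\<close>

lemma OPT_le_change_start:
  assumes k: "k \<ge> 1" and X: "set X \<subseteq> {0..1}"
    and range: "\<And>i j. i < length X \<Longrightarrow> j < k \<Longrightarrow> q i j \<in> {0..1}"
    and serve: "\<And>i. i < length X \<Longrightarrow> \<exists>j<k. q i j = X ! i"
  shows "OPT k X \<le> real k + (\<Sum>i<length X - 1. move_cost k (q i) (q (Suc i)))"
proof -
  let ?p = "case_nat (\<lambda>_. 0) q"
  have "?p i j \<in> {0..1}" if "i \<le> length X" "j < k" for i j
    using that range by (cases i) auto
  moreover have "\<exists>j<k. ?p i j = X ! (i - 1)" if "i \<in> {1..length X}" for i
    using that serve[of "i - 1"] by (cases i) auto
  ultimately have "valid_solution k X ?p" by (auto simp: valid_solution_def)
  then have "OPT k X \<le> cost k (length X) ?p" by (rule OPT_minimum(2)[OF k X])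
  also have "\<dots> \<le> real k + (\<Sum>i<length X - 1. move_cost k (q i) (q (Suc i)))"
  proof (cases "length X")
    case (Suc n)
    have "move_cost k (\<lambda>_. 0) (q 0) \<le> real k"
      using range[of 0] Suc by (intro move_cost_le) auto
    then show ?thesis
      by (simp add: cost_eq_move_cost Suc sum.lessThan_Suc_shift del: sum.lessThan_Suc)
  qed (simp add: cost_def)
  finally show ?thesis .
qed

text \<open>Dropping the first move of an optimal solution frees its starting configuration.\<close>

lemma OPT_solution:
  assumes k: "k \<ge> 1" and X: "set X \<subseteq> {0..1}"
  obtains q where "\<And>i j. i < length X \<Longrightarrow> j < k \<Longrightarrow> q i j \<in> {0..1}"
    and "\<And>i. i < length X \<Longrightarrow> \<exists>j<k. q i j = X ! i"
    and "(\<Sum>i<length X - 1. move_cost k (q i) (q (Suc i))) \<le> OPT k X"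
proof -
  obtain p where p: "valid_solution k X p" "cost k (length X) p = OPT k X"
    using OPT_minimum(1)[OF k X] by blast
  have "(\<Sum>i<length X - 1. move_cost k (p (Suc i)) (p (Suc (Suc i)))) \<le> OPT k X"
  proof (cases "length X")
    case (Suc n)
    show ?thesis
      using move_cost_nonneg[of k "p 0" "p 1"]
      by (simp add: p(2)[symmetric] cost_eq_move_cost Suc sum.lessThan_Suc_shift del: sum.lessThan_Suc)
  qed (use p(2) in \<open>simp add: cost_def\<close>)
  moreover have "p (Suc i) j \<in> {0..1}" if "i < length X" "j < k" for i j
    using p(1) that by (auto simp: valid_solution_def)
  moreover have "\<exists>j<k. p (Suc i) j = X ! i" if "i < length X" for i
    using p(1) that unfolding valid_solution_def by (metis Suc_leI atLeastAtMost_iff diff_Suc_1 le_numeral_extra(4) plus_1_eq_Suc le_add1)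
  ultimately show ?thesis using that[of "\<lambda>i. p (Suc i)"] by blast
qed

text \<open>Run backwards, a schedule makes the same moves at the same cost; only reaching its new
  start is extra.\<close>

lemma OPT_rev_le:
  assumes k: "k \<ge> 1" and X: "set X \<subseteq> {0..1}"
  shows "OPT k X \<le> OPT k (rev X) + real k"
proof -
  have "set (rev X) \<subseteq> {0..1}" using X by simp
  from OPT_solution[OF k this]
  obtain q where q: "\<And>i j. i < length X \<Longrightarrow> j < k \<Longrightarrow> q i j \<in> {0..1}"
    "\<And>i. i < length X \<Longrightarrow> \<exists>j<k. q i j = rev X ! i"
    "(\<Sum>i<length X - 1. move_cost k (q i) (q (Suc i))) \<le> OPT k (rev X)"
    unfolding length_rev by blast
  let ?q = "\<lambda>i. q (length X - Suc i)"
  have "OPT k X \<le> real k + (\<Sum>i<length X - 1. move_cost k (?q i) (?q (Suc i)))"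
  proof (rule OPT_le_change_start[OF k X])
    show "\<exists>j<k. ?q i j = X ! i" if "i < length X" for i
      using q(2)[of "length X - Suc i"] that by (simp add: rev_nth Suc_diff_Suc)
  qed (use q(1) in auto)
  also have "(\<Sum>i<length X - 1. move_cost k (?q i) (?q (Suc i))) =
      (\<Sum>i<length X - 1. move_cost k (q i) (q (Suc i)))"
    \<comment> \<open>There are \<open>length X - 1\<close> moves between requests; the witness
      reverses their order.\<close>
    by (rule sum.reindex_bij_witness[of _ "\<lambda>i. length X - 1 - Suc i" "\<lambda>i. length X - 1 - Suc i"])
      (auto simp: move_cost_commute Suc_diff_Suc numeral_2_eq_2 intro!: arg_cong2[of _ _ _ _ "move_cost k"])
  finally show ?thesis using q(3) by simp
qed

text \<open>Reflection is an isometry of \<open>[0,1]\<close>, so only the start changes.\<close>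

lemma OPT_reflect_le:
  assumes k: "k \<ge> 1" and X: "set X \<subseteq> {0..1}"
  shows "OPT k X \<le> OPT k (map (\<lambda>x. 1 - x) X) + real k"
proof -
  have "set (map (\<lambda>x. 1 - x) X) \<subseteq> {0..1}" using X by auto
  from OPT_solution[OF k this]
  obtain q where q: "\<And>i j. i < length X \<Longrightarrow> j < k \<Longrightarrow> q i j \<in> {0..1}"
    "\<And>i. i < length X \<Longrightarrow> \<exists>j<k. q i j = map (\<lambda>x. 1 - x) X ! i"
    "(\<Sum>i<length X - 1. move_cost k (q i) (q (Suc i))) \<le> OPT k (map (\<lambda>x. 1 - x) X)"
    unfolding length_map by blast
  let ?q = "\<lambda>i j. 1 - q i j"
  have "OPT k X \<le> real k + (\<Sum>i<length X - 1. move_cost k (?q i) (?q (Suc i)))"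
  proof (rule OPT_le_change_start[OF k X])
    show "\<exists>j<k. ?q i j = X ! i" if "i < length X" for i
      using q(2)[OF that] that by force
  qed (use q(1) in auto)
  also have "\<dots> = real k + (\<Sum>i<length X - 1. move_cost k (q i) (q (Suc i)))"
    by (simp add: move_cost_def abs_minus_commute)
  finally show ?thesis using q(3) by simp
qed

section \<open>Patterns under reversal and reflection\<close>

lemma subseq_revI: "subseq xs ys \<Longrightarrow> subseq (rev xs) (rev ys)"
proof (induction rule: list_emb.induct)
  case (list_emb_Cons2 x y xs ys)
  then show ?case using list_emb_append_mono[of "(=)" "rev xs" "rev ys" "[x]" "[y]"] by simp
qed (auto intro: subseq_rev_drop_many)

lemma subseq_rev_triple: "subseq [u, v, w] (rev X) \<longleftrightarrow> subseq [w, v, u] X"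
  using subseq_revI[of "[w, v, u]" X] subseq_revI[of "[u, v, w]" "rev X"] by auto

lemma subseq_reflect_triple:
  assumes "subseq [u, v, w] (map (\<lambda>x. 1 - x) X)"
  shows "subseq [1 - u, 1 - v, 1 - w] (X :: real list)"
  using subseq_map[OF assms, of "\<lambda>x. 1 - x"] by (simp add: comp_def)

lemma avoids_132_rev: "avoids X [1,3,2] \<Longrightarrow> avoids (rev X) [2,3,1]"
  unfolding avoids_231_iff avoids_132_iff subseq_rev_triple by blast

lemma avoids_312_rev: "avoids X [3,1,2] \<Longrightarrow> avoids (rev X) [2,1,3]"
  unfolding avoids_312_iff avoids_213_iff subseq_rev_triple by blast

lemma avoids_213_reflect:
  assumes "avoids X [2,1,3]"
  shows "avoids (map (\<lambda>x. 1 - x) X) [2,3,1]"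
  unfolding avoids_231_iff
proof (intro allI impI)
  fix u v w :: real
  assume "subseq [u, v, w] (map (\<lambda>x. 1 - x) X)"
  from subseq_reflect_triple[OF this] assms show "\<not> (w < u \<and> u < v)"
    unfolding avoids_213_iff by fastforce
qed

theorem theorem3p8:
  fixes \<sigma> :: "real list"
  assumes "\<sigma> \<in> {[1,3,2], [2,1,3], [2,3,1], [3,1,2]}"
  shows "\<exists>C::real. \<forall>(k::nat) (n::nat) (X::real list).
           k \<ge> 1 \<longrightarrow> length X = n \<longrightarrow> set X \<subseteq> {0..1} \<longrightarrow> avoids X \<sigma> \<longrightarrow>
           OPT k X \<le> C * (real k ^ 2 + real k * real n powr (1 / real k))"
proof (intro exI[of _ 7] allI impI)
  fix k n :: nat and X :: "real list"
  assume k: "k \<ge> 1" and n: "length X = n" and X: "set X \<subseteq> {0..1}" and av: "avoids X \<sigma>"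
  let ?r = "real n powr (1 / real k)"
  let ?f = "map (\<lambda>x::real. 1 - x)"
  have main: "OPT k Y \<le> real k * (2 * ?r + 5)"
    if "length Y = n" "set Y \<subseteq> {0..1}" "avoids Y [2,3,1]" for Y
    using OPT_le_231[OF k that(2,3)] that(1) by simp
  have refl: "set (?f Y) \<subseteq> {0..1}" if "set Y \<subseteq> {0..1}" for Y
    using that by auto
  consider "\<sigma> = [1,3,2]" | "\<sigma> = [2,1,3]" | "\<sigma> = [2,3,1]" | "\<sigma> = [3,1,2]"
    using assms by auto
  \<comment> \<open>Each reversal or reflection costs \<open>k\<close>; at most two are
    used.\<close>
  then have "OPT k X \<le> real k * (2 * ?r + 5) + 2 * real k"
  proof cases
    case 1
    then show ?thesis
      using main[of "rev X"] av n X avoids_132_rev OPT_rev_le[OF k X] by simp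
  next
    case 2
    then show ?thesis
      using main[of "?f X"] av n refl[OF X] avoids_213_reflect OPT_reflect_le[OF k X] by simp
  next
    case 3
    then show ?thesis using main[of X] av n X by simp
  next
    case 4
    \<comment> \<open>Reversal turns 312 into 213, and reflection turns that into 231.\<close>
    then have "avoids (?f (rev X)) [2,3,1]"
      using av avoids_312_rev avoids_213_reflect by blast
    then show ?thesis
      using main[of "?f (rev X)"] n X refl[of "rev X"] OPT_rev_le[OF k X]
        OPT_reflect_le[OF k, of "rev X"] by simp
  qed
  also have "\<dots> = 2 * (real k * ?r) + 7 * real k"
    by (simp add: algebra_simps)
  \<comment> \<open>The constant is 7 = 5 + 2; \<open>k <= k ^ 2\<close> absorbs the linear
    term.\<close>
  also have "\<dots> \<le> 7 * (real k * ?r) + 7 * real k ^ 2"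
    using k by (intro add_mono mult_right_mono mult_left_mono self_le_power) auto
  also have "\<dots> = 7 * (real k ^ 2 + real k * ?r)" by simp
  finally show "OPT k X \<le> 7 * (real k ^ 2 + real k * ?r)" .
qed

end
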